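(* Let $\mathcal{X}=(x_n)_{n=1}^\infty$ be a basis of a quasi-Banach space $\mathbb{X}$. Then $\mathcal{X}$ is nearly unconditional if and only if it is nearly truncation quasi-greedy. Moreover, when these equivalent conditions hold, $$\lambda(a)\lesssim \theta(a)\lesssim \phi(a)\lesssim \frac{1}{a}\,\lambda(a),\qquad 0<a<1,$$ where $\lambda$, $\theta$, $\phi$ are the nearly truncation quasi-greedy function, the thresholding-boundedness function and the near unconditionality function of $\mathcal{X}$, and $\lesssim$ means inequality up to a multiplicative constant independent of $a$.
   Context: $\mathbb{X}$ is an infinite-dimensional separable quasi-Banach space over the real or complex field $\mathbb{F}$. A basis of $\mathbb{X}$ is a norm-bounded sequence $\mathcal{X}=(x_n)_{n=1}^\infty$ with $\overline{\mathrm{span}}(x_n: n\in\mathbb{N})=\mathbb{X}$ for which there is a (unique) norm-bounded sequence $(x_n^* )_{n=1}^\infty$ in $\mathbb{X}^*$ such that $(x_n,x_n^* )_{n=1}^\infty$ is a biorthogonal system. For finite $A\subseteq\mathbb{N}$, $S_A(f)=\sum_{n\in A}x_n^*(f)\,x_n$. Put $\mathcal{Q}=\{f\in\mathbb{X}: \sup_n|x_n^*(f)|\le 1\}$ and, for $a>0$ and $f\in\mathbb{X}$, $A(a,f)=\{n\in\mathbb{N}: |x_n^*(f)|\ge a\}$ (a finite set). For finite $A\subseteq\mathbb{N}$ let $$\mathcal{R}(f,A)=\min_{n\in A}|x_n^*(f)|\sum_{n\in A}\mathrm{sign}(x_n^*(f))\,x_n$$ (equal to $0$ if $A=\emptyset$),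 where $\mathrm{sign}(z)=z/|z|$ for $z\ne0$, and put $\mathcal{R}^{(a)}(f)=\mathcal{R}(f,A(a,f))$. The basis is nearly unconditional if for each $a\in(0,1)$ there is a constant $C$ such that $\|S_A(f)\|\le C\|f\|$ for all $f\in\mathcal{Q}$ and all $A\subseteq A(a,f)$; $\phi(a)$ denotes the smallest such $C$. It is thresholding-bounded if for each $a\in(0,1)$ there is a constant $C$ such that $\|S_{A(a,f)}(f)\|\le C\|f\|$ for all $f\in\mathcal{Q}$; $\theta(a)$ denotes the smallest such $C$. It is nearly truncation quasi-greedy if for each $a\in(0,1)$ there is a constant $C$ such that $\|\mathcal{R}^{(a)}(f)\|\le C\|f\|$ for all $f\in\mathcal{Q}$; $\lambda(a)$ denotes the smallest such $C$. *)

theory Defs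
  imports "HOL-Analysis.Analysis"
begin

text \<open>
  The scalar field is a type of class \<open>real_normed_field\<close>: up to isometric isomorphism
  the only such fields are \<open>real\<close> and \<open>complex\<close>, so this is the real and the complex
  case at once. A quasi-norm does not fit the class \<open>real_normed_vector\<close> (the triangle inequality
  fails), so the space is a type of vectors with an explicit scalar multiplication \<open>scl\<close> and an
  explicit quasi-norm \<open>qnorm\<close>.
\<close>

text \<open>Quasi-balls are neighbourhoods (not necessarily open sets) in the quasi-norm topology, so
  this is the closure in that topology.\<close>
definition qclosure :: "('v::ab_group_add \<Rightarrow> real) \<Rightarrow> 'v set \<Rightarrow> 'v set" where
  "qclosure qnorm S = {f. \<forall>e>0. \<exists>g\<in>S. qnorm (f - g) < e}"

definition qCauchy :: "('v::ab_group_add \<Rightarrow> real) \<Rightarrow> (nat \<Rightarrow> 'v) \<Rightarrow> bool" where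
  "qCauchy qnorm s \<longleftrightarrow> (\<forall>e>0. \<exists>N. \<forall>m\<ge>N. \<forall>n\<ge>N. qnorm (s m - s n) < e)"

locale quasi_banach_space = vector_space scl
  for scl :: "'f::real_normed_field \<Rightarrow> 'v::ab_group_add \<Rightarrow> 'v" +
  fixes qnorm :: "'v \<Rightarrow> real"
  assumes qnorm_nonneg: "0 \<le> qnorm f"
    and qnorm_eq_0_iff: "qnorm f = 0 \<longleftrightarrow> f = 0"
    and qnorm_scl: "qnorm (scl c f) = norm c * qnorm f"
    and qnorm_quasi_triangle: "\<exists>\<kappa>. \<forall>f g. qnorm (f + g) \<le> \<kappa> * (qnorm f + qnorm g)"
    and complete: "qCauchy qnorm s \<Longrightarrow> \<exists>l. (\<lambda>n. qnorm (s n - l)) \<longlonglongrightarrow> 0"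

locale separable_infinite_dim_quasi_banach_space = quasi_banach_space scl qnorm
  for scl :: "'f::real_normed_field \<Rightarrow> 'v::ab_group_add \<Rightarrow> 'v" and qnorm :: "'v \<Rightarrow> real" +
  assumes infinite_dim: "\<nexists>B. finite B \<and> span B = UNIV"
    and separable: "\<exists>D. countable D \<and> qclosure qnorm D = UNIV"

text \<open>As for normed spaces, a linear functional is continuous iff it is bounded.\<close>
definition dual_space ::
    "('f::real_normed_field \<Rightarrow> 'v::ab_group_add \<Rightarrow> 'v) \<Rightarrow> ('v \<Rightarrow> real) \<Rightarrow> ('v \<Rightarrow> 'f) set" where
  "dual_space scl qnorm =
    {u. Vector_Spaces.linear scl (*) u \<and> (\<exists>C. \<forall>f. norm (u f) \<le> C * qnorm f)}"

definition dual_norm :: "('v::ab_group_add \<Rightarrow> real) \<Rightarrow> ('v \<Rightarrow> 'f::real_normed_field) \<Rightarrow> real" where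
  "dual_norm qnorm u = (SUP f\<in>{f. qnorm f \<le> 1}. norm (u f))"

text \<open>The coordinate functionals \<open>xs\<close> are determined by \<open>x\<close> (continuity, biorthogonality and
  density of the span), so they are carried as a second parameter.\<close>
locale quasi_banach_basis = separable_infinite_dim_quasi_banach_space scl qnorm
  for scl :: "'f::real_normed_field \<Rightarrow> 'v::ab_group_add \<Rightarrow> 'v" and qnorm :: "'v \<Rightarrow> real" +
  fixes x :: "nat \<Rightarrow> 'v" and xs :: "nat \<Rightarrow> 'v \<Rightarrow> 'f"
  assumes x_bounded: "\<exists>C. \<forall>n. qnorm (x n) \<le> C"
    and x_span_dense: "qclosure qnorm (span (range x)) = UNIV"
    and xs_dual: "xs n \<in> dual_space scl qnorm"
    and xs_bounded: "\<exists>C. \<forall>n. dual_norm qnorm (xs n) \<le> C"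
    and biorthogonal: "xs n (x m) = (if n = m then 1 else 0)"

definition coord_proj ::
    "('f::real_normed_field \<Rightarrow> 'v::ab_group_add \<Rightarrow> 'v) \<Rightarrow> (nat \<Rightarrow> 'v) \<Rightarrow> (nat \<Rightarrow> 'v \<Rightarrow> 'f)
      \<Rightarrow> nat set \<Rightarrow> 'v \<Rightarrow> 'v" where
  "coord_proj scl x xs A f = (\<Sum>n\<in>A. scl (xs n f) (x n))"

definition Q_set :: "(nat \<Rightarrow> 'v \<Rightarrow> 'f::real_normed_field) \<Rightarrow> 'v set" where
  "Q_set xs = {f. \<forall>n. norm (xs n f) \<le> 1}"

text \<open>Finite for \<open>a > 0\<close> when \<open>xs\<close> are the coordinate functionals of a basis.\<close>
definition level_set :: "(nat \<Rightarrow> 'v \<Rightarrow> 'f::real_normed_field) \<Rightarrow> real \<Rightarrow> 'v \<Rightarrow> nat set" where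
  "level_set xs a f = {n. a \<le> norm (xs n f)}"

text \<open>The library's \<open>sgn z\<close> is \<open>z / |z|\<close> for \<open>z \<noteq> 0\<close>. Its value at \<open>0\<close> is immaterial: if some
  coordinate in \<open>A\<close> vanishes, so does the minimum.\<close>
definition restricted_truncation ::
    "('f::real_normed_field \<Rightarrow> 'v::ab_group_add \<Rightarrow> 'v) \<Rightarrow> (nat \<Rightarrow> 'v) \<Rightarrow> (nat \<Rightarrow> 'v \<Rightarrow> 'f)
      \<Rightarrow> 'v \<Rightarrow> nat set \<Rightarrow> 'v" where
  "restricted_truncation scl x xs f A =
    (if A = {} then 0
     else scl (of_real (Min ((\<lambda>n. norm (xs n f)) ` A))) (\<Sum>n\<in>A. scl (sgn (xs n f)) (x n)))"

definition near_unconditionality_bound ::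
    "('f::real_normed_field \<Rightarrow> 'v::ab_group_add \<Rightarrow> 'v) \<Rightarrow> ('v \<Rightarrow> real) \<Rightarrow> (nat \<Rightarrow> 'v)
      \<Rightarrow> (nat \<Rightarrow> 'v \<Rightarrow> 'f) \<Rightarrow> real \<Rightarrow> real \<Rightarrow> bool" where
  "near_unconditionality_bound scl qnorm x xs a C \<longleftrightarrow>
    (\<forall>f\<in>Q_set xs. \<forall>A. A \<subseteq> level_set xs a f \<longrightarrow>
      qnorm (coord_proj scl x xs A f) \<le> C * qnorm f)"

definition nearly_unconditional ::
    "('f::real_normed_field \<Rightarrow> 'v::ab_group_add \<Rightarrow> 'v) \<Rightarrow> ('v \<Rightarrow> real) \<Rightarrow> (nat \<Rightarrow> 'v)
      \<Rightarrow> (nat \<Rightarrow> 'v \<Rightarrow> 'f) \<Rightarrow> bool" where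
  "nearly_unconditional scl qnorm x xs \<longleftrightarrow>
    (\<forall>a. 0 < a \<and> a < 1 \<longrightarrow> (\<exists>C. near_unconditionality_bound scl qnorm x xs a C))"

definition near_unconditionality_fun ::
    "('f::real_normed_field \<Rightarrow> 'v::ab_group_add \<Rightarrow> 'v) \<Rightarrow> ('v \<Rightarrow> real) \<Rightarrow> (nat \<Rightarrow> 'v)
      \<Rightarrow> (nat \<Rightarrow> 'v \<Rightarrow> 'f) \<Rightarrow> real \<Rightarrow> real" where
  "near_unconditionality_fun scl qnorm x xs a =
    (LEAST C. near_unconditionality_bound scl qnorm x xs a C)"

definition thresholding_bound ::
    "('f::real_normed_field \<Rightarrow> 'v::ab_group_add \<Rightarrow> 'v) \<Rightarrow> ('v \<Rightarrow> real) \<Rightarrow> (nat \<Rightarrow> 'v)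
      \<Rightarrow> (nat \<Rightarrow> 'v \<Rightarrow> 'f) \<Rightarrow> real \<Rightarrow> real \<Rightarrow> bool" where
  "thresholding_bound scl qnorm x xs a C \<longleftrightarrow>
    (\<forall>f\<in>Q_set xs. qnorm (coord_proj scl x xs (level_set xs a f) f) \<le> C * qnorm f)"

definition thresholding_bounded ::
    "('f::real_normed_field \<Rightarrow> 'v::ab_group_add \<Rightarrow> 'v) \<Rightarrow> ('v \<Rightarrow> real) \<Rightarrow> (nat \<Rightarrow> 'v)
      \<Rightarrow> (nat \<Rightarrow> 'v \<Rightarrow> 'f) \<Rightarrow> bool" where
  "thresholding_bounded scl qnorm x xs \<longleftrightarrow>
    (\<forall>a. 0 < a \<and> a < 1 \<longrightarrow> (\<exists>C. thresholding_bound scl qnorm x xs a C))"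

definition thresholding_fun ::
    "('f::real_normed_field \<Rightarrow> 'v::ab_group_add \<Rightarrow> 'v) \<Rightarrow> ('v \<Rightarrow> real) \<Rightarrow> (nat \<Rightarrow> 'v)
      \<Rightarrow> (nat \<Rightarrow> 'v \<Rightarrow> 'f) \<Rightarrow> real \<Rightarrow> real" where
  "thresholding_fun scl qnorm x xs a = (LEAST C. thresholding_bound scl qnorm x xs a C)"

definition near_truncation_bound ::
    "('f::real_normed_field \<Rightarrow> 'v::ab_group_add \<Rightarrow> 'v) \<Rightarrow> ('v \<Rightarrow> real) \<Rightarrow> (nat \<Rightarrow> 'v)
      \<Rightarrow> (nat \<Rightarrow> 'v \<Rightarrow> 'f) \<Rightarrow> real \<Rightarrow> real \<Rightarrow> bool" where
  "near_truncation_bound scl qnorm x xs a C \<longleftrightarrow>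
    (\<forall>f\<in>Q_set xs. qnorm (restricted_truncation scl x xs f (level_set xs a f)) \<le> C * qnorm f)"

definition nearly_truncation_quasi_greedy ::
    "('f::real_normed_field \<Rightarrow> 'v::ab_group_add \<Rightarrow> 'v) \<Rightarrow> ('v \<Rightarrow> real) \<Rightarrow> (nat \<Rightarrow> 'v)
      \<Rightarrow> (nat \<Rightarrow> 'v \<Rightarrow> 'f) \<Rightarrow> bool" where
  "nearly_truncation_quasi_greedy scl qnorm x xs \<longleftrightarrow>
    (\<forall>a. 0 < a \<and> a < 1 \<longrightarrow> (\<exists>C. near_truncation_bound scl qnorm x xs a C))"

definition near_truncation_fun ::
    "('f::real_normed_field \<Rightarrow> 'v::ab_group_add \<Rightarrow> 'v) \<Rightarrow> ('v \<Rightarrow> real) \<Rightarrow> (nat \<Rightarrow> 'v)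
      \<Rightarrow> (nat \<Rightarrow> 'v \<Rightarrow> 'f) \<Rightarrow> real \<Rightarrow> real" where
  "near_truncation_fun scl qnorm x xs a = (LEAST C. near_truncation_bound scl qnorm x xs a C)"

end

theory Submission
  imports Defs
begin

text \<open>
  A thresholding bound at level \<open>a\<close> holds at every level \<open>b \<ge> a\<close>, since rescaling \<open>f\<close> by \<open>a / b\<close> turns
  the threshold \<open>b\<close> into \<open>a\<close>. For \<open>\<lambda> \<lesssim> \<theta>\<close>, cut \<open>A(a,f)\<close> into slices on which the moduli of the
  coordinates vary by a factor at most \<open>M = 2 \<kappa>\<close>, where \<open>\<kappa>\<close> is the modulus of concavity. A slice is
  the difference of two sets \<open>A(b,f)\<close> with \<open>b \<ge> a\<close>, and on it near unconditionality at the fixed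
  level \<open>1 / M\<close> allows truncation; truncation shrinks the \<open>k\<close>-th slice by \<open>1 / M\<^sup>k\<close>, which beats the
  loss \<open>\<kappa>\<^sup>k\<close> in the quasi-triangle inequality. For \<open>\<phi> \<lesssim> \<lambda> / a\<close>, finiteness of \<open>\<lambda>(1/2)\<close> alone
  makes sums \<open>\<Sum> \<epsilon>\<^sub>n x\<^sub>n\<close> with unimodular \<open>\<epsilon>\<^sub>n\<close> unconditional with a constant that does not depend
  on \<open>a\<close>; \<open>S\<^sub>B(f)\<close> is such a sum over \<open>A(a,f)\<close> with weights in \<open>[0,1]\<close>.
\<close>

text \<open>\<open>LEAST\<close> over the reals is meaningful only if a minimum is attained. Each
  \<open>s\<close> with \<open>0 < r s\<close> cuts out a closed half-line of constants, each
  \<open>s\<close> with \<open>r s = 0\<close> gives a condition free of the constant, and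
  \<open>s0\<close> bounds the set below by 0.\<close>

lemma ratio_bound_Least:
  fixes l r :: "'a \<Rightarrow> real"
  assumes nonneg: "\<And>s. s \<in> S \<Longrightarrow> 0 \<le> r s"
    and s0: "s0 \<in> S" "0 \<le> l s0" "0 < r s0"
    and C: "\<forall>s\<in>S. l s \<le> C * r s"
  defines "c \<equiv> LEAST C. \<forall>s\<in>S. l s \<le> C * r s"
  shows "0 \<le> c" and "\<forall>s\<in>S. l s \<le> c * r s" and "c \<le> C"
proof -
  define T where "T = {C. \<forall>s\<in>S. l s \<le> C * r s}"
  have T_nonneg: "0 \<le> D" if "D \<in> T" for D
  proof -
    have "0 \<le> D * r s0" using that s0 by (force simp: T_def)
    then show ?thesis using s0 by (simp add: zero_le_mult_iff)
  qed
  have bdd: "bdd_below T" using T_nonneg by (rule bdd_belowI)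
  have CT: "C \<in> T" using C by (simp add: T_def)
  have Inf: "Inf T \<in> T"
    unfolding T_def
  proof (intro CollectI ballI)
    fix s assume s: "s \<in> S"
    show "l s \<le> Inf {C. \<forall>s\<in>S. l s \<le> C * r s} * r s"
    proof (cases "r s = 0")
      case True
      then show ?thesis using C s by force
    next
      case False
      then have r: "0 < r s" using nonneg[OF s] by simp
      have "l s / r s \<le> Inf T"
        using CT by (intro cInf_greatest) (auto simp: T_def s r pos_divide_le_eq)
      then show ?thesis using r by (simp add: T_def pos_divide_le_eq)
    qed
  qed
  have "c = Inf T"
    unfolding c_def using Inf bdd
    by (intro Least_equality) (auto simp: T_def intro: cInf_lower)
  then show "0 \<le> c" "\<forall>s\<in>S. l s \<le> c * r s" "c \<le> C"
    using Inf T_nonneg cInf_lower[OF CT bdd] by (auto simp: T_def)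
qed

section \<open>Sums of vectors under a quasi-norm\<close>

context quasi_banach_space
begin

text \<open>A modulus of concavity, not necessarily the least one; the normalisation
  \<open>1 \<le> \<kappa>\<close> makes the powers of \<open>2 * modulus\<close> increase.\<close>

definition modulus :: real where
  "modulus = (SOME \<kappa>. 1 \<le> \<kappa> \<and> (\<forall>f g. qnorm (f + g) \<le> \<kappa> * (qnorm f + qnorm g)))"

lemma modulus: "1 \<le> modulus" "qnorm (f + g) \<le> modulus * (qnorm f + qnorm g)"
proof -
  obtain \<kappa> where \<kappa>: "\<And>f g. qnorm (f + g) \<le> \<kappa> * (qnorm f + qnorm g)"
    using qnorm_quasi_triangle by blast
  have "qnorm (f + g) \<le> max 1 \<kappa> * (qnorm f + qnorm g)" for f g
    by (rule order_trans[OF \<kappa>]) (intro mult_right_mono, auto simp: qnorm_nonneg)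
  then have "1 \<le> max 1 \<kappa> \<and> (\<forall>f g. qnorm (f + g) \<le> max 1 \<kappa> * (qnorm f + qnorm g))"
    by simp
  then have "1 \<le> modulus \<and> (\<forall>f g. qnorm (f + g) \<le> modulus * (qnorm f + qnorm g))"
    unfolding modulus_def by (rule someI)
  then show "1 \<le> modulus" "qnorm (f + g) \<le> modulus * (qnorm f + qnorm g)" by auto
qed

lemma qnorm_0 [simp]: "qnorm 0 = 0"
  by (simp add: qnorm_eq_0_iff)

lemma qnorm_minus: "qnorm (- f) = qnorm f"
  using qnorm_scl[of "-1" f] by simp

lemma qnorm_scl_of_real: "0 \<le> c \<Longrightarrow> qnorm (scl (of_real c) f) = c * qnorm f"
  by (simp add: qnorm_scl)

lemma qnorm_add_le:
  assumes "qnorm f \<le> a" "qnorm g \<le> b"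
  shows "qnorm (f + g) \<le> modulus * (a + b)"
  by (rule order_trans[OF modulus(2)]) (use assms modulus(1) in \<open>auto intro!: mult_left_mono\<close>)

lemma qnorm_diff_le:
  assumes "qnorm f \<le> a" "qnorm g \<le> b"
  shows "qnorm (f - g) \<le> modulus * (a + b)"
  using qnorm_add_le[of f a "- g" b] assms by (simp add: qnorm_minus)

text \<open>Each further term costs at most a factor \<open>2 * modulus\<close>. This is affordable
  where \<open>n\<close> depends only on \<open>modulus\<close>.\<close>

lemma qnorm_sum_le_pow:
  fixes u :: "nat \<Rightarrow> 'v"
  assumes "\<And>j. j < n \<Longrightarrow> qnorm (u j) \<le> K" and "0 \<le> K"
  shows "qnorm (\<Sum>j<n. u j) \<le> (2 * modulus) ^ n * K"
  using assms
proof (induction n)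
  case (Suc n)
  have "qnorm ((\<Sum>j<n. u j) + u n) \<le> modulus * ((2 * modulus) ^ n * K + K)"
    using Suc by (intro qnorm_add_le) auto
  also have "\<dots> \<le> modulus * ((2 * modulus) ^ n * K + (2 * modulus) ^ n * K)"
  proof -
    have "1 * K \<le> (2 * modulus) ^ n * K"
      using modulus(1) Suc.prems(2) by (intro mult_right_mono one_le_power) auto
    then show ?thesis
      using modulus(1) by (intro mult_left_mono add_left_mono) simp_all
  qed
  finally show ?case by (simp add: algebra_simps)
qed simp

text \<open>Induction removes the first term: the tail satisfies the hypothesis with
  \<open>C / (2 * modulus)\<close>, so it is bounded by \<open>C\<close>, and joining it to the head
  costs \<open>modulus * (C + C)\<close>, whatever \<open>n\<close> is.\<close>

lemma qnorm_sum_geometric: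
  fixes u :: "nat \<Rightarrow> 'v"
  assumes "\<And>k. k < n \<Longrightarrow> qnorm (u k) \<le> C / (2 * modulus) ^ k" and "0 \<le> C"
  shows "qnorm (\<Sum>k<n. u k) \<le> 2 * modulus * C"
  using assms
proof (induction n arbitrary: u C)
  case 0
  then show ?case using modulus(1) by simp
next
  case (Suc n)
  have "qnorm (\<Sum>k<n. u (Suc k)) \<le> 2 * modulus * (C / (2 * modulus))"
  proof (rule Suc.IH)
    fix k assume "k < n"
    then show "qnorm (u (Suc k)) \<le> C / (2 * modulus) / (2 * modulus) ^ k"
      using Suc.prems(1)[of "Suc k"] by (simp add: field_simps)
  qed (use modulus(1) Suc.prems in auto)
  then have "qnorm (\<Sum>k<n. u (Suc k)) \<le> C"
    using modulus(1) by simp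
  then have "qnorm (u 0 + (\<Sum>k<n. u (Suc k))) \<le> modulus * (C + C)"
    using Suc.prems(1)[of 0] by (intro qnorm_add_le) auto
  then show ?case unfolding sum.lessThan_Suc_shift by (simp add: algebra_simps)
qed

text \<open>The bound may depend on \<open>A\<close> and \<open>v\<close>; it serves to make the
  supremum over weights in \<open>qnorm_weighted_sum_le\<close> finite.\<close>

lemma qnorm_weighted_sum_bounded:
  assumes "finite A"
  shows "\<exists>b. \<forall>w. (\<forall>n\<in>A. 0 \<le> w n \<and> w n \<le> 1)
    \<longrightarrow> qnorm (\<Sum>n\<in>A. scl (of_real (w n)) (v n)) \<le> b"
  using assms
proof (induction rule: finite_induct)
  case empty
  then show ?case by auto
next
  case (insert a A)
  then obtain b where b: "\<And>w. (\<forall>n\<in>A. 0 \<le> w n \<and> w n \<le> 1)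
    \<Longrightarrow> qnorm (\<Sum>n\<in>A. scl (of_real (w n)) (v n)) \<le> b" by blast
  have "qnorm (\<Sum>n\<in>insert a A. scl (of_real (w n)) (v n)) \<le> modulus * (qnorm (v a) + b)"
    if w: "\<forall>n\<in>insert a A. 0 \<le> w n \<and> w n \<le> 1" for w
  proof -
    have "qnorm (scl (of_real (w a)) (v a)) \<le> qnorm (v a)"
      using w by (simp add: qnorm_scl_of_real mult_left_le_one_le qnorm_nonneg)
    then show ?thesis using insert b[of w] w by (simp add: qnorm_add_le)
  qed
  then show ?case by blast
qed

text \<open>The price of adding \<open>\<lceil>2 * modulus\<rceil>\<close> vectors by
  \<open>qnorm_sum_le_pow\<close>.\<close>

definition multiplier_const :: real where
  "multiplier_const = (2 * modulus) ^ nat \<lceil>2 * modulus\<rceil>"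

lemma multiplier_const_ge_1: "1 \<le> multiplier_const"
  unfolding multiplier_const_def using modulus(1) by (intro one_le_power) auto

text \<open>Local convexity is not available to pass from \<open>{0,1}\<close>-valued to \<open>[0,1]\<close>-valued weights.
  Instead write \<open>N w = \<lfloor>N w\<rfloor> + w'\<close> with \<open>w'\<close> again \<open>[0,1]\<close>-valued: the integer part is a sum of \<open>N\<close>
  indicator functions, and for \<open>N \<ge> 2 \<kappa>\<close> the remainder is absorbed into the supremum.\<close>
lemma qnorm_weighted_sum_le:
  fixes w :: "'i \<Rightarrow> real" and v :: "'i \<Rightarrow> 'v"
  assumes A: "finite A" and K: "\<And>B. B \<subseteq> A \<Longrightarrow> qnorm (\<Sum>n\<in>B. v n) \<le> K"
    and w: "\<And>n. n \<in> A \<Longrightarrow> 0 \<le> w n \<and> w n \<le> 1"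
  shows "qnorm (\<Sum>n\<in>A. scl (of_real (w n)) (v n)) \<le> multiplier_const * K"
proof -
  define N where "N = nat \<lceil>2 * modulus\<rceil>"
  define D where "D = multiplier_const * K"
  define W where "W = {w :: 'i \<Rightarrow> real. \<forall>n\<in>A. 0 \<le> w n \<and> w n \<le> 1}"
  define F where "F = (\<lambda>w. qnorm (\<Sum>n\<in>A. scl (of_real (w n)) (v n)))"
  have N: "2 * modulus \<le> real N" unfolding N_def by linarith
  then have N_pos: "0 < real N" using modulus(1) by linarith
  have K_nonneg: "0 \<le> K" using K[of "{}"] by simp
  have bdd: "bdd_above (F ` W)"
  proof -
    obtain b where "\<And>w. w \<in> W \<Longrightarrow> F w \<le> b"
      using qnorm_weighted_sum_bounded[OF A, of v] unfolding F_def W_def by blast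
    then show ?thesis by (rule bdd_aboveI2)
  qed
  have step: "F u \<le> (D + Sup (F ` W)) / 2" if u: "u \<in> W" for u
  proof -
    define d where "d n = nat \<lfloor>N * u n\<rfloor>" for n
    define u' where "u' n = N * u n - d n" for n
    have d: "real (d n) = of_int \<lfloor>N * u n\<rfloor>" "d n \<le> N" if "n \<in> A" for n
    proof -
      have un: "0 \<le> u n" "u n \<le> 1" using u that by (auto simp: W_def)
      then show "real (d n) = of_int \<lfloor>N * u n\<rfloor>" unfolding d_def by simp
      have "real N * u n \<le> real N" using un N_pos by (simp add: mult_left_le)
      then show "d n \<le> N" unfolding d_def by linarith
    qed
    have "u' \<in> W"
      unfolding W_def u'_def using d(1) by (auto simp: le_floor_iff) linarith
    then have rem: "F u' \<le> Sup (F ` W)" using bdd by (auto intro: cSup_upper)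
    \<comment> \<open>Layer by layer: \<open>d n\<close> counts the \<open>j < N\<close> with
      \<open>j < d n\<close>, so swapping the sums leaves \<open>N\<close> sums of \<open>v\<close>
      over subsets of \<open>A\<close>, each bounded by \<open>K\<close>.\<close>
    have "(\<Sum>n\<in>A. scl (of_real (real (d n))) (v n)) = (\<Sum>n\<in>A. \<Sum>j<N. if j < d n then v n else 0)"
    proof (rule sum.cong[OF refl])
      fix n assume n: "n \<in> A"
      have "(\<Sum>j<N. if j < d n then v n else 0) = (\<Sum>j\<in>{..<N} \<inter> {j. j < d n}. v n)"
        by (subst sum.inter_restrict) simp_all
      also have "{..<N} \<inter> {j. j < d n} = {..<d n}" using d(2)[OF n] by auto
      also have "(\<Sum>j<d n. v n) = (\<Sum>j<d n. scl 1 (v n))" by simp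
      also have "\<dots> = scl (of_real (real (d n))) (v n)"
        by (subst scale_sum_left[symmetric]) simp
      finally show "scl (of_real (real (d n))) (v n) = (\<Sum>j<N. if j < d n then v n else 0)" ..
    qed
    also have "\<dots> = (\<Sum>j<N. \<Sum>n\<in>{n\<in>A. j < d n}. v n)"
      by (subst sum.swap) (simp add: sum.inter_filter A)
    finally have int: "qnorm (\<Sum>n\<in>A. scl (of_real (real (d n))) (v n)) \<le> D"
      unfolding D_def multiplier_const_def N_def[symmetric]
      using K K_nonneg by (simp only:) (rule qnorm_sum_le_pow, auto)
    have "scl (of_real (u n)) (v n)
        = scl (of_real (1 / N)) (scl (of_real (real (d n))) (v n) + scl (of_real (u' n)) (v n))" for n
    proof -
      have "u n = 1 / N * (real (d n) + u' n)" using N_pos by (simp add: u'_def)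
      then show ?thesis
        by (metis of_real_add of_real_mult scale_left_distrib scale_scale)
    qed
    then have "(\<Sum>n\<in>A. scl (of_real (u n)) (v n)) = scl (of_real (1 / N))
        ((\<Sum>n\<in>A. scl (of_real (real (d n))) (v n)) + (\<Sum>n\<in>A. scl (of_real (u' n)) (v n)))"
      by (simp add: scale_sum_right sum.distrib scale_right_distrib)
    then have "F u = 1 / N * qnorm
        ((\<Sum>n\<in>A. scl (of_real (real (d n))) (v n)) + (\<Sum>n\<in>A. scl (of_real (u' n)) (v n)))"
      unfolding F_def using N_pos by (simp only: qnorm_scl_of_real zero_le_divide_1_iff less_imp_le)
    also have "\<dots> \<le> 1 / N * (modulus * (D + Sup (F ` W)))"
      using int rem N_pos unfolding F_def by (intro mult_left_mono qnorm_add_le) auto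
    also have "\<dots> = modulus / N * (D + Sup (F ` W))" by simp
    also have "\<dots> \<le> 1 / 2 * (D + Sup (F ` W))"
    proof (rule mult_right_mono)
      show "modulus / N \<le> 1 / 2" using N N_pos by (simp add: field_simps)
      have "0 \<le> F u'" by (simp add: F_def qnorm_nonneg)
      moreover have "0 \<le> D"
        unfolding D_def using multiplier_const_ge_1 K_nonneg by simp
      ultimately show "0 \<le> D + Sup (F ` W)" using rem by linarith
    qed
    finally show ?thesis by simp
  qed
  have "w \<in> W" using w by (simp add: W_def)
  \<comment> \<open>The supremum S is finite, so S \<le> (D + S) / 2 forces S \<le> D.\<close>
  then have "Sup (F ` W) \<le> (D + Sup (F ` W)) / 2"
    using step by (intro cSup_least) blast+
  moreover have "F w \<le> (D + Sup (F ` W)) / 2" using \<open>w \<in> W\<close> by (rule step)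
  ultimately have "F w \<le> D" by argo
  then show ?thesis by (simp add: F_def D_def)
qed

end

section \<open>Coordinates, level sets and least constants\<close>

context quasi_banach_basis
begin

lemma xs_module_hom: "module_hom scl (*) (xs n)"
  using xs_dual[of n] unfolding dual_space_def
  by (simp add: Vector_Spaces.linear_iff_module_hom)

lemmas xs_add = module_hom.add[OF xs_module_hom]
  and xs_diff = module_hom.diff[OF xs_module_hom]
  and xs_scl = module_hom.scale[OF xs_module_hom]
  and xs_zero = module_hom.zero[OF xs_module_hom]
  and xs_sum = module_hom.sum[OF xs_module_hom]

lemma xs_sum_x:
  assumes "finite A"
  shows "xs m (\<Sum>n\<in>A. scl (c n) (x n)) = (if m \<in> A then c m else 0)"
  using assms by (simp add: xs_sum xs_scl biorthogonal if_distrib[of "\<lambda>y. _ * y"] cong: if_cong)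

text \<open>The supremum \<open>dual_norm\<close> is an upper bound only once its set is known to be
  bounded above; membership in \<open>dual_space\<close> provides that.\<close>

lemma norm_xs_le_dual_norm: "norm (xs n f) \<le> dual_norm qnorm (xs n) * qnorm f"
proof (cases "f = 0")
  case True
  then show ?thesis by (simp add: xs_zero)
next
  case False
  then have pos: "0 < qnorm f" using qnorm_nonneg[of f] qnorm_eq_0_iff[of f] by linarith
  obtain C where C: "\<And>f. norm (xs n f) \<le> C * qnorm f"
    using xs_dual[of n] unfolding dual_space_def by auto
  have "norm (xs n g) \<le> \<bar>C\<bar>" if "qnorm g \<le> 1" for g
  proof -
    have "norm (xs n g) \<le> \<bar>C\<bar> * qnorm g"
      by (rule order_trans[OF C]) (auto intro: mult_right_mono qnorm_nonneg)
    also have "\<dots> \<le> \<bar>C\<bar> * 1" using that by (intro mult_left_mono) auto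
    finally show ?thesis by simp
  qed
  then have bdd: "bdd_above ((\<lambda>f. norm (xs n f)) ` {f. qnorm f \<le> 1})"
    by (intro bdd_aboveI2) auto
  define g where "g = scl (of_real (1 / qnorm f)) f"
  have "qnorm g = 1" using pos unfolding g_def by (subst qnorm_scl_of_real) auto
  then have "norm (xs n g) \<le> dual_norm qnorm (xs n)"
    unfolding dual_norm_def using bdd by (intro cSUP_upper) auto
  then show ?thesis using pos by (simp add: g_def xs_scl norm_mult norm_divide field_simps)
qed

text \<open>Density gives \<open>g\<close> with finitely many nonzero coordinates, so close to
  \<open>f\<close> that the uniform bound on the functionals puts every coordinate of
  \<open>f - g\<close> below \<open>a\<close>. On the level set the coordinates of \<open>g\<close>
  then cannot vanish.\<close>

lemma finite_level_set:
  assumes "0 < a"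
  shows "finite (level_set xs a f)"
proof -
  obtain C where C: "\<And>n. dual_norm qnorm (xs n) \<le> C" using xs_bounded by blast
  define D where "D = \<bar>C\<bar> + 1"
  have D: "norm (xs n h) \<le> D * qnorm h" for n h
    by (rule order_trans[OF norm_xs_le_dual_norm])
       (use C[of n] in \<open>auto intro!: mult_right_mono qnorm_nonneg simp: D_def\<close>)
  have D_pos: "0 < D" by (simp add: D_def)
  have "f \<in> qclosure qnorm (span (range x))" using x_span_dense by simp
  then obtain g where g: "g \<in> span (range x)" "qnorm (f - g) < a / D"
    using divide_pos_pos[OF assms D_pos] unfolding qclosure_def by blast
  have "finite {n. xs n g \<noteq> 0}"
    using g(1)
  proof (induction rule: span_induct_alt)
    case base
    then show ?case by (simp add: xs_zero)
  next
    case (step c b y)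
    then obtain m where "b = x m" by auto
    then have "{n. xs n (scl c b + y) \<noteq> 0} \<subseteq> insert m {n. xs n y \<noteq> 0}"
      by (auto simp: xs_add xs_scl biorthogonal split: if_splits)
    then show ?case using step finite_subset by blast
  qed
  moreover have "level_set xs a f \<subseteq> {n. xs n g \<noteq> 0}"
  proof
    fix n assume "n \<in> level_set xs a f"
    moreover have "norm (xs n (f - g)) < a"
      using D[of n "f - g"] g(2) D_pos by (simp add: field_simps)
    ultimately show "n \<in> {n. xs n g \<noteq> 0}" by (auto simp: level_set_def xs_diff)
  qed
  ultimately show ?thesis by (rule rev_finite_subset)
qed

lemma x_in_Q: "x n \<in> Q_set xs"
  by (simp add: Q_set_def biorthogonal)

text \<open>With \<open>x_in_Q\<close>, this makes \<open>x 0\<close> a test vector that forces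
  admissible constants to be nonnegative.\<close>

lemma qnorm_x_pos: "0 < qnorm (x n)"
proof -
  have "x n \<noteq> 0" using biorthogonal[of n n] xs_zero[of n] by auto
  then show ?thesis using qnorm_nonneg[of "x n"] qnorm_eq_0_iff[of "x n"] by linarith
qed

lemma coord_proj_scl: "coord_proj scl x xs A (scl c f) = scl c (coord_proj scl x xs A f)"
  by (simp add: coord_proj_def xs_scl scale_sum_right)

lemma coord_proj_coord_proj:
  assumes "finite A" "B \<subseteq> A"
  shows "coord_proj scl x xs B (coord_proj scl x xs A f) = coord_proj scl x xs B f"
  unfolding coord_proj_def using assms by (intro sum.cong) (auto simp: xs_sum_x)

lemma thresholding_bound_nonneg:
  assumes "thresholding_bound scl qnorm x xs a C"
  shows "0 \<le> C"
proof -
  have "0 \<le> C * qnorm (x 0)"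
    using assms x_in_Q[of 0] qnorm_nonneg order_trans unfolding thresholding_bound_def by blast
  then show ?thesis using qnorm_x_pos[of 0] by (simp add: zero_le_mult_iff)
qed

lemma near_unconditionality_bound_Least:
  assumes "near_unconditionality_bound scl qnorm x xs a C"
  shows "0 \<le> near_unconditionality_fun scl qnorm x xs a"
    and "near_unconditionality_bound scl qnorm x xs a (near_unconditionality_fun scl qnorm x xs a)"
    and "near_unconditionality_fun scl qnorm x xs a \<le> C"
proof -
  \<comment> \<open>Two quantified objects are packed into a pair to fit
    \<open>ratio_bound_Least\<close>.\<close>
  let ?S = "{(f, A). f \<in> Q_set xs \<and> A \<subseteq> level_set xs a f}"
  have eq: "near_unconditionality_bound scl qnorm x xs a = (\<lambda>C. \<forall>s\<in>?S.
      qnorm (coord_proj scl x xs (snd s) (fst s)) \<le> C * qnorm (fst s))"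
    unfolding near_unconditionality_bound_def by auto
  note * = ratio_bound_Least[of ?S "\<lambda>s. qnorm (fst s)" "(x 0, {})"
      "\<lambda>s. qnorm (coord_proj scl x xs (snd s) (fst s))" C]
  show "0 \<le> near_unconditionality_fun scl qnorm x xs a"
    "near_unconditionality_bound scl qnorm x xs a (near_unconditionality_fun scl qnorm x xs a)"
    "near_unconditionality_fun scl qnorm x xs a \<le> C"
    unfolding near_unconditionality_fun_def eq
    by (rule *; use assms x_in_Q qnorm_x_pos in \<open>simp add: qnorm_nonneg eq\<close>)+
qed

lemma thresholding_bound_Least:
  assumes "thresholding_bound scl qnorm x xs a C"
  shows "0 \<le> thresholding_fun scl qnorm x xs a"
    and "thresholding_bound scl qnorm x xs a (thresholding_fun scl qnorm x xs a)"
    and "thresholding_fun scl qnorm x xs a \<le> C"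
  unfolding thresholding_fun_def thresholding_bound_def
  by (rule ratio_bound_Least[of _ _ "x 0" _ C];
      use assms x_in_Q qnorm_x_pos in \<open>simp add: qnorm_nonneg thresholding_bound_def\<close>)+

lemma near_truncation_bound_Least:
  assumes "near_truncation_bound scl qnorm x xs a C"
  shows "0 \<le> near_truncation_fun scl qnorm x xs a"
    and "near_truncation_bound scl qnorm x xs a (near_truncation_fun scl qnorm x xs a)"
    and "near_truncation_fun scl qnorm x xs a \<le> C"
  unfolding near_truncation_fun_def near_truncation_bound_def
  by (rule ratio_bound_Least[of _ _ "x 0" _ C];
      use assms x_in_Q qnorm_x_pos in \<open>simp add: qnorm_nonneg near_truncation_bound_def\<close>)+

section \<open>Truncation bounded through thresholding\<close>

lemma thresholding_bound_if_near_unconditionality_bound: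
  "near_unconditionality_bound scl qnorm x xs a C \<Longrightarrow> thresholding_bound scl qnorm x xs a C"
  by (simp add: near_unconditionality_bound_def thresholding_bound_def)

lemma thresholding_bound_mono:
  assumes "thresholding_bound scl qnorm x xs a C" "0 < a" "a \<le> b"
  shows "thresholding_bound scl qnorm x xs b C"
  unfolding thresholding_bound_def
proof
  fix f assume f: "f \<in> Q_set xs"
  \<comment> \<open>Since \<open>c \<le> 1\<close>, rescaling stays in \<open>Q_set\<close>. The
    level \<open>b\<close> may exceed 1, as the upper end of a slice can.\<close>
  define c where "c = a / b"
  have c: "0 < c" "c \<le> 1" using assms by (auto simp: c_def)
  let ?g = "scl (of_real c) f"
  have "norm (xs n ?g) \<le> 1" for n
    using f c by (auto simp: Q_set_def xs_scl norm_mult intro: mult_le_one)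
  then have "?g \<in> Q_set xs" by (simp add: Q_set_def)
  moreover have "level_set xs a ?g = level_set xs b f"
    using assms by (auto simp: level_set_def xs_scl norm_mult norm_divide c_def field_simps)
  ultimately have "qnorm (coord_proj scl x xs (level_set xs b f) ?g) \<le> C * qnorm ?g"
    using assms(1) unfolding thresholding_bound_def by metis
  then show "qnorm (coord_proj scl x xs (level_set xs b f) f) \<le> C * qnorm f"
    using c by (simp add: coord_proj_scl qnorm_scl_of_real mult.left_commute)
qed

text \<open>On a slice where the moduli of the coordinates vary by a factor at most \<open>1 / b\<close>, near
  unconditionality at \<open>b\<close> is plain unconditionality.\<close>
lemma near_unconditionality_slice:
  assumes "near_unconditionality_bound scl qnorm x xs b K" and A: "finite A" and B: "B \<subseteq> A"
    and t: "0 < t" and coords: "\<And>n. n \<in> A \<Longrightarrow> b * t \<le> norm (xs n f) \<and> norm (xs n f) \<le> t"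
  shows "qnorm (coord_proj scl x xs B f) \<le> K * qnorm (coord_proj scl x xs A f)"
proof -
  \<comment> \<open>Projecting to \<open>A\<close> first discards the coordinates outside
    \<open>A\<close>, which may exceed \<open>t\<close>; then division by \<open>t\<close> lands in
    \<open>Q_set\<close>.\<close>
  define g where "g = coord_proj scl x xs A f"
  define h where "h = scl (of_real (1 / t)) g"
  have h: "norm (xs n h) = (if n \<in> A then norm (xs n f) / t else 0)" for n
    using t A by (simp add: h_def g_def xs_scl coord_proj_def xs_sum_x norm_mult norm_divide)
  have "h \<in> Q_set xs" using coords t by (simp add: Q_set_def h)
  moreover have "B \<subseteq> level_set xs b h"
    using B coords t by (auto simp: level_set_def h pos_le_divide_eq)
  ultimately have "qnorm (coord_proj scl x xs B h) \<le> K * qnorm h"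
    using assms(1) unfolding near_unconditionality_bound_def by blast
  moreover have "coord_proj scl x xs B h = scl (of_real (1 / t)) (coord_proj scl x xs B f)"
    unfolding h_def g_def coord_proj_scl coord_proj_coord_proj[OF A B] ..
  ultimately have "1 / t * qnorm (coord_proj scl x xs B f) \<le> K * (1 / t * qnorm g)"
    unfolding h_def using t qnorm_scl_of_real[of "1 / t"] by simp
  then show ?thesis using t by (simp add: g_def field_simps)
qed

text \<open>Half-open, so that consecutive slices are disjoint and each is a difference of two level
  sets.\<close>

definition slice :: "real \<Rightarrow> real \<Rightarrow> 'v \<Rightarrow> nat set" where
  "slice s t f = {n. s \<le> norm (xs n f) \<and> norm (xs n f) < t}"

lemma qnorm_coord_proj_slice_le:
  assumes "thresholding_bound scl qnorm x xs a C" "0 < a" "a \<le> s" "s \<le> t" "f \<in> Q_set xs"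
  shows "qnorm (coord_proj scl x xs (slice s t f) f) \<le> 2 * modulus * C * qnorm f"
proof -
  have bound: "qnorm (coord_proj scl x xs (level_set xs r f) f) \<le> C * qnorm f" if "a \<le> r" for r
    using thresholding_bound_mono[OF assms(1,2) that] assms(5) by (simp add: thresholding_bound_def)
  have "slice s t f = level_set xs s f - level_set xs t f"
    by (auto simp: slice_def level_set_def)
  moreover have "level_set xs t f \<subseteq> level_set xs s f"
    using assms by (auto simp: level_set_def)
  ultimately have "coord_proj scl x xs (slice s t f) f
      = coord_proj scl x xs (level_set xs s f) f - coord_proj scl x xs (level_set xs t f) f"
    using finite_level_set assms unfolding coord_proj_def by (simp only: sum_diff)
  then show ?thesis
    using qnorm_diff_le[OF bound[of s] bound[of t]] assms(3,4) by (simp add: mult_ac)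
qed

text \<open>One factor \<open>2 * modulus\<close> comes from writing a slice as a difference,
  another from the geometric summation, \<open>K\<close> from unconditionality on a slice,
  \<open>multiplier_const\<close> from the truncating weights. The level of \<open>K\<close> is
  fixed, so the bound depends on \<open>a\<close> only through \<open>C\<close>.\<close>

lemma near_truncation_bound_if_thresholding_bound:
  assumes K: "near_unconditionality_bound scl qnorm x xs (1 / (2 * modulus)) K"
    and C: "thresholding_bound scl qnorm x xs a C" and a: "0 < a" and K0: "0 \<le> K"
  shows "near_truncation_bound scl qnorm x xs a (4 * modulus ^ 2 * multiplier_const * K * C)"
  unfolding near_truncation_bound_def
proof
  fix f assume f: "f \<in> Q_set xs"
  let ?A = "level_set xs a f"
  define M where "M = 2 * modulus"
  have M: "2 \<le> M" using modulus(1) by (simp add: M_def)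
  have C0: "0 \<le> C" using thresholding_bound_nonneg[OF C] .
  have A: "finite ?A" using finite_level_set[OF a] .
  show "qnorm (restricted_truncation scl x xs f ?A)
      \<le> 4 * modulus ^ 2 * multiplier_const * K * C * qnorm f"
  proof (cases "?A = {}")
    case True
    then show ?thesis
      using modulus(1) multiplier_const_ge_1 K0 C0 qnorm_nonneg[of f]
      by (simp add: restricted_truncation_def)
  next
    case False
    define m where "m = Min ((\<lambda>n. norm (xs n f)) ` ?A)"
    have m_le: "m \<le> norm (xs n f)" if "n \<in> ?A" for n
      unfolding m_def using A that by simp
    have am: "a \<le> m" unfolding m_def using A False by (simp add: level_set_def)
    then have m: "0 < m" using a by simp
    \<comment> \<open>On slice \<open>k\<close> the moduli are at least \<open>M ^ k * m\<close>, so
      the truncating factor \<open>m / norm (xs n f)\<close> splits into the weight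
      \<open>w k n\<close> in [0,1] and the decay \<open>1 / M ^ k\<close>.\<close>
    define w where "w k n = M ^ k * m / norm (xs n f)" for k n
    define sl where "sl k = slice (M ^ k * m) (M ^ Suc k * m) f" for k
    have Mk: "1 \<le> M ^ k" for k using M by simp
    have aMk: "a \<le> M ^ k * m" for k
    proof -
      have "1 * m \<le> M ^ k * m" using Mk[of k] m by (intro mult_right_mono) auto
      then show ?thesis using am by simp
    qed
    have sl_A: "sl k \<subseteq> ?A" for k
      using aMk[of k] by (auto simp: sl_def slice_def level_set_def)
    have fin: "finite (sl k)" for k using sl_A A finite_subset by blast
    define u where "u k = scl (of_real (1 / M ^ k))
      (\<Sum>n\<in>sl k. scl (of_real (w k n)) (scl (xs n f) (x n)))" for k
    have u: "qnorm (u k) \<le> (multiplier_const * (K * (M * C * qnorm f))) / M ^ k" for k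
    proof -
      let ?g = "coord_proj scl x xs (sl k) f"
      have g: "qnorm ?g \<le> M * C * qnorm f"
        unfolding sl_def M_def[symmetric] using aMk[of k] M m
        by (auto simp: M_def[symmetric] intro!: qnorm_coord_proj_slice_le[OF C a, folded M_def] f)
      have "qnorm (\<Sum>n\<in>sl k. scl (of_real (w k n)) (scl (xs n f) (x n)))
          \<le> multiplier_const * (K * qnorm ?g)"
      proof (rule qnorm_weighted_sum_le[OF fin])
        fix B assume B: "B \<subseteq> sl k"
        have "qnorm (coord_proj scl x xs B f) \<le> K * qnorm ?g"
          by (rule near_unconditionality_slice[OF K fin B, where t = "M ^ Suc k * m"])
             (use M m in \<open>auto simp: sl_def slice_def M_def[symmetric]\<close>)
        then show "qnorm (\<Sum>n\<in>B. scl (xs n f) (x n)) \<le> K * qnorm ?g"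
          by (simp add: coord_proj_def)
      next
        fix n assume "n \<in> sl k"
        moreover have "0 < M ^ k * m" using M m by simp
        ultimately show "0 \<le> w k n \<and> w k n \<le> 1"
          by (auto simp: w_def sl_def slice_def divide_le_eq_1)
      qed
      also have "\<dots> \<le> multiplier_const * (K * (M * C * qnorm f))"
        using g K0 multiplier_const_ge_1 by (intro mult_left_mono) auto
      finally show ?thesis
        unfolding u_def using M by (subst qnorm_scl_of_real) (auto intro: divide_right_mono)
    qed
    define r where "r n = scl (of_real (m / norm (xs n f))) (scl (xs n f) (x n))" for n
    have u_eq: "u k = (\<Sum>n\<in>sl k. r n)" for k
      unfolding u_def scale_sum_right r_def
    proof (rule sum.cong[OF refl])
      fix n
      have "1 / M ^ k * w k n = m / norm (xs n f)" using M by (simp add: w_def)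
      then show "scl (of_real (1 / M ^ k)) (scl (of_real (w k n)) (scl (xs n f) (x n)))
          = scl (of_real (m / norm (xs n f))) (scl (xs n f) (x n))"
        by (metis of_real_mult scale_scale)
    qed
    \<comment> \<open>Coordinates have modulus at most 1, so \<open>p\<close> slices exhaust the
      level set. Although \<open>p\<close> depends on \<open>f\<close>, the geometric bound is
      independent of \<open>p\<close>.\<close>
    obtain p where p: "1 / m < M ^ p" using real_arch_pow[of M "1 / m"] M by auto
    have cover: "?A = (\<Union>k<p. sl k)"
    proof (intro equalityI subsetI)
      fix n assume n: "n \<in> ?A"
      have "norm (xs n f) \<le> 1" using f by (simp add: Q_set_def)
      then have lt: "norm (xs n f) < M ^ p * m" using p m by (simp add: field_simps)
      \<comment> \<open>The first exponent whose threshold exceeds the modulus; it is not 0 because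
        \<open>m\<close> is the minimum, and its predecessor is the slice index.\<close>
      define q where "q = (LEAST q. norm (xs n f) < M ^ q * m)"
      have q: "norm (xs n f) < M ^ q * m" unfolding q_def using lt by (rule LeastI)
      have "q \<le> p" unfolding q_def using lt by (rule Least_le)
      have "q \<noteq> 0" using q m_le[OF n] by (intro notI) simp
      then obtain k where k: "q = Suc k" using not0_implies_Suc by blast
      have "\<not> norm (xs n f) < M ^ k * m"
        using not_less_Least[of k "\<lambda>q. norm (xs n f) < M ^ q * m"] k unfolding q_def by simp
      then have "n \<in> sl k" using q k by (simp add: sl_def slice_def)
      then show "n \<in> (\<Union>k<p. sl k)" using \<open>q \<le> p\<close> k by auto
    qed (use sl_A in auto)
    have disj: "sl i \<inter> sl j = {}" if "i < j" for i j
    proof -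
      have "M ^ Suc i * m \<le> M ^ j * m"
        using that M m by (intro mult_right_mono power_increasing) auto
      then show ?thesis by (auto simp: sl_def slice_def)
    qed
    have "restricted_truncation scl x xs f ?A = (\<Sum>n\<in>?A. r n)"
      unfolding restricted_truncation_def m_def[symmetric] r_def
      using False by (simp add: scale_sum_right sgn_div_norm scaleR_conv_of_real field_simps)
    also have "\<dots> = (\<Sum>k<p. u k)"
      unfolding cover u_eq using fin disj
      by (intro sum.UNION_disjoint) (auto, metis IntI empty_iff nat_neq_iff)
    also have "qnorm \<dots> \<le> M * (multiplier_const * (K * (M * C * qnorm f)))"
      unfolding M_def
      by (rule qnorm_sum_geometric)
         (use u M multiplier_const_ge_1 K0 C0 qnorm_nonneg[of f] in \<open>auto simp: M_def\<close>)
    finally show ?thesis by (simp add: M_def power2_eq_square algebra_simps)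
  qed
qed

section \<open>Unconditionality recovered from truncation\<close>

text \<open>Lowering the coordinates outside \<open>B\<close> by an arbitrarily small amount makes \<open>B\<close> a level set.\<close>
lemma sign_unconditional:
  assumes L: "near_truncation_bound scl qnorm x xs (1 / 2) L" and L0: "0 \<le> L" and A: "finite A"
    and eps: "\<And>n. n \<in> A \<Longrightarrow> norm (\<epsilon> n) = 1" and B: "B \<subseteq> A"
  shows "qnorm (\<Sum>n\<in>B. scl (\<epsilon> n) (x n)) \<le> modulus * L * qnorm (\<Sum>n\<in>A. scl (\<epsilon> n) (x n))"
proof (cases "B = {}")
  case True
  then show ?thesis using L0 modulus(1) by (simp add: qnorm_nonneg)
next
  case False
  define h where "h = (\<Sum>n\<in>A. scl (\<epsilon> n) (x n))"
  define v where "v = (\<Sum>n\<in>A - B. scl (\<epsilon> n) (x n))"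
  define y where "y = (\<Sum>n\<in>B. scl (\<epsilon> n) (x n))"
  have fin: "finite B" using A B finite_subset by blast
  have *: "qnorm y \<le> modulus * L * qnorm h + \<delta> * (2 * modulus * L * qnorm v)"
    if \<delta>: "0 < \<delta>" "\<delta> < 1 / 2" for \<delta>
  proof -
    define f where "f = scl (of_real (1 / 2)) h - scl (of_real \<delta>) v"
    have xs_f: "xs n f = of_real (if n \<in> B then 1 / 2 else if n \<in> A then 1 / 2 - \<delta> else 0) * \<epsilon> n"
      for n
      using A B fin by (auto simp: f_def h_def v_def xs_diff xs_scl xs_sum_x algebra_simps)
    have norm_f: "norm (xs n f) = (if n \<in> B then 1 / 2 else if n \<in> A then 1 / 2 - \<delta> else 0)" for n
      unfolding xs_f using eps[of n] B \<delta> by (auto simp: norm_mult simp flip: of_real_diff of_real_divide)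
    have "f \<in> Q_set xs" using \<delta> by (simp add: Q_set_def norm_f)
    moreover have "level_set xs (1 / 2) f = B" using \<delta> by (auto simp: level_set_def norm_f)
    moreover have "restricted_truncation scl x xs f B = scl (of_real (1 / 2)) y"
    proof -
      have "(\<lambda>n. norm (xs n f)) ` B = {1 / 2}" using False by (auto simp: norm_f)
      moreover have "sgn (xs n f) = \<epsilon> n" if "n \<in> B" for n
        using norm_f[of n] that by (simp add: sgn_div_norm xs_f scaleR_conv_of_real)
      ultimately show ?thesis using False by (simp add: restricted_truncation_def y_def)
    qed
    ultimately have "qnorm (scl (of_real (1 / 2)) y) \<le> L * qnorm f"
      using L unfolding near_truncation_bound_def by force
    then have "1 / 2 * qnorm y \<le> L * qnorm f" by (subst (asm) qnorm_scl_of_real) auto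
    also have "L * qnorm f \<le> L * (modulus * (1 / 2 * qnorm h + \<delta> * qnorm v))"
      unfolding f_def using \<delta> L0
      by (intro mult_left_mono qnorm_diff_le) (simp_all only: qnorm_scl_of_real order_refl)
    finally show ?thesis by (simp add: algebra_simps)
  qed
  \<comment> \<open>A quasi-norm need not be continuous, so the limit is taken in the explicit bound
    and not in the quasi-norm of the perturbed vector.\<close>
  have "((\<lambda>\<delta>. modulus * L * qnorm h + \<delta> * (2 * modulus * L * qnorm v)) \<longlongrightarrow>
      modulus * L * qnorm h + 0 * (2 * modulus * L * qnorm v)) (at_right 0)"
    by (intro tendsto_intros)
  moreover have "\<forall>\<^sub>F \<delta> in at_right 0.
      qnorm y \<le> modulus * L * qnorm h + \<delta> * (2 * modulus * L * qnorm v)"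
    unfolding eventually_at_right_field using * by (intro exI[of _ "1 / 2"]) auto
  ultimately have "qnorm y \<le> modulus * L * qnorm h + 0 * (2 * modulus * L * qnorm v)"
    by (rule tendsto_lowerbound) simp
  then show ?thesis by (simp add: y_def h_def)
qed

text \<open>The factor \<open>1 / a\<close> arises because the minimum carried by
  \<open>restricted_truncation\<close> is at least \<open>a\<close>; dividing it out bounds the full
  sign sum \<open>y\<close>.\<close>

lemma near_unconditionality_bound_if_near_truncation_bound:
  assumes L: "near_truncation_bound scl qnorm x xs (1 / 2) L" and L0: "0 \<le> L"
    and C: "near_truncation_bound scl qnorm x xs a C" and a: "0 < a" and C0: "0 \<le> C"
  shows "near_unconditionality_bound scl qnorm x xs a
    (multiplier_const * modulus * L * (1 / a * C))"
  unfolding near_unconditionality_bound_def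
proof (intro ballI allI impI)
  fix f B assume f: "f \<in> Q_set xs" and B: "B \<subseteq> level_set xs a f"
  let ?A = "level_set xs a f"
  have A: "finite ?A" using finite_level_set[OF a] .
  define y where "y = (\<Sum>n\<in>?A. scl (sgn (xs n f)) (x n))"
  have y: "qnorm y \<le> 1 / a * C * qnorm f"
  proof (cases "?A = {}")
    case True
    then show ?thesis unfolding y_def True using a C0 qnorm_nonneg[of f] by simp
  next
    case False
    define m where "m = Min ((\<lambda>n. norm (xs n f)) ` ?A)"
    have am: "a \<le> m" unfolding m_def using A False by (simp add: level_set_def)
    have "m * qnorm y = qnorm (restricted_truncation scl x xs f ?A)"
      using False am a by (simp add: restricted_truncation_def m_def[symmetric] y_def qnorm_scl_of_real)
    also have "\<dots> \<le> C * qnorm f" using C f unfolding near_truncation_bound_def by blast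
    finally have "a * qnorm y \<le> C * qnorm f"
      using mult_right_mono[OF am qnorm_nonneg[of y]] by linarith
    then show ?thesis using a by (simp add: field_simps)
  qed
  \<comment> \<open>Moduli times signs restore the coordinates; the value 0 outside \<open>B\<close>
    selects \<open>B\<close>, and \<open>Q_set\<close> keeps the weights in [0,1].\<close>
  define w where "w n = (if n \<in> B then norm (xs n f) else 0)" for n
  have "coord_proj scl x xs B f = (\<Sum>n\<in>?A. if n \<in> B then scl (xs n f) (x n) else 0)"
    unfolding coord_proj_def using A B by (simp add: sum.inter_restrict[symmetric] Int_absorb1)
  also have "\<dots> = (\<Sum>n\<in>?A. scl (of_real (w n)) (scl (sgn (xs n f)) (x n)))"
    by (rule sum.cong) (auto simp: w_def sgn_div_norm scaleR_conv_of_real)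
  also have "qnorm \<dots> \<le> multiplier_const * (modulus * L * qnorm y)"
    unfolding y_def
  proof (rule qnorm_weighted_sum_le[OF A])
    fix D assume "D \<subseteq> ?A"
    \<comment> \<open>A modulus of at least \<open>a > 0\<close> rules out
      \<open>sgn 0 = 0\<close>.\<close>
    moreover have "norm (sgn (xs n f)) = 1" if "n \<in> ?A" for n
      using that a by (auto simp: level_set_def norm_sgn)
    ultimately show "qnorm (\<Sum>n\<in>D. scl (sgn (xs n f)) (x n))
        \<le> modulus * L * qnorm (\<Sum>n\<in>?A. scl (sgn (xs n f)) (x n))"
      by (intro sign_unconditional[OF L L0 A])
  qed (use f in \<open>auto simp: w_def Q_set_def\<close>)
  also have "\<dots> \<le> multiplier_const * (modulus * L * (1 / a * C * qnorm f))"
    using y L0 modulus(1) multiplier_const_ge_1 by (intro mult_left_mono) auto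
  finally show "qnorm (coord_proj scl x xs B f)
      \<le> multiplier_const * modulus * L * (1 / a * C) * qnorm f"
    by (simp add: algebra_simps)
qed

section \<open>Constants independent of \<open>a\<close>\<close>

lemma nearly_unconditional_imp_thresholding_bounded:
  "nearly_unconditional scl qnorm x xs \<Longrightarrow> thresholding_bounded scl qnorm x xs"
  unfolding nearly_unconditional_def thresholding_bounded_def
  using thresholding_bound_if_near_unconditionality_bound by blast

text \<open>\<open>c\<close> precedes \<open>a\<close> and \<open>C\<close> because it comes from
  the single level \<open>1 / (2 * modulus)\<close>. Allowing any \<open>C\<close> serves both the
  qualitative implication and the least constants.\<close>

lemma near_truncation_le_thresholding:
  assumes "nearly_unconditional scl qnorm x xs"
  obtains c where "0 \<le> c"
    and "\<And>a C. 0 < a \<Longrightarrow> thresholding_bound scl qnorm x xs a C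
      \<Longrightarrow> near_truncation_bound scl qnorm x xs a (c * C)"
proof -
  have "0 < 1 / (2 * modulus)" "1 / (2 * modulus) < 1" using modulus(1) by auto
  then obtain K where "near_unconditionality_bound scl qnorm x xs (1 / (2 * modulus)) K"
    using assms unfolding nearly_unconditional_def by blast
  note K = near_unconditionality_bound_Least(1,2)[OF this]
  show thesis
    by (rule that[OF _ near_truncation_bound_if_thresholding_bound[OF K(2) _ _ K(1)]])
       (use K(1) multiplier_const_ge_1 in auto)
qed

lemma near_unconditionality_le_near_truncation:
  assumes "nearly_truncation_quasi_greedy scl qnorm x xs"
  obtains c where "0 \<le> c"
    and "\<And>a C. 0 < a \<Longrightarrow> 0 \<le> C \<Longrightarrow> near_truncation_bound scl qnorm x xs a C
      \<Longrightarrow> near_unconditionality_bound scl qnorm x xs a (c * (1 / a * C))"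
proof -
  have "0 < (1 / 2 :: real) \<and> (1 / 2 :: real) < 1" by simp
  then obtain L where "near_truncation_bound scl qnorm x xs (1 / 2) L"
    using assms unfolding nearly_truncation_quasi_greedy_def by blast
  note L = near_truncation_bound_Least(1,2)[OF this]
  show thesis
    by (rule that[OF _ near_unconditionality_bound_if_near_truncation_bound[OF L(2,1)]])
       (use L(1) multiplier_const_ge_1 modulus(1) in auto)
qed

lemma nearly_unconditional_iff_nearly_truncation_quasi_greedy:
  "nearly_unconditional scl qnorm x xs \<longleftrightarrow> nearly_truncation_quasi_greedy scl qnorm x xs"
proof
  assume nu: "nearly_unconditional scl qnorm x xs"
  then show "nearly_truncation_quasi_greedy scl qnorm x xs"
    using near_truncation_le_thresholding[OF nu] nearly_unconditional_imp_thresholding_bounded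
    unfolding nearly_truncation_quasi_greedy_def thresholding_bounded_def by metis
next
  assume nt: "nearly_truncation_quasi_greedy scl qnorm x xs"
  \<comment> \<open>\<open>near_truncation_bound_Least\<close> trades an arbitrary constant for a
    nonnegative one.\<close>
  then show "nearly_unconditional scl qnorm x xs"
    using near_unconditionality_le_near_truncation[OF nt] near_truncation_bound_Least(1,2)
    unfolding nearly_truncation_quasi_greedy_def nearly_unconditional_def by metis
qed

end

theorem theorem3p4:
  fixes scl :: "'f::real_normed_field \<Rightarrow> 'v::ab_group_add \<Rightarrow> 'v"
    and qnorm :: "'v \<Rightarrow> real"
    and x :: "nat \<Rightarrow> 'v"
    and xs :: "nat \<Rightarrow> 'v \<Rightarrow> 'f"
  assumes "quasi_banach_basis scl qnorm x xs"
  shows "(nearly_unconditional scl qnorm x xs \<longleftrightarrow> nearly_truncation_quasi_greedy scl qnorm x xs) \<and>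
    (nearly_unconditional scl qnorm x xs \<longrightarrow>
      thresholding_bounded scl qnorm x xs \<and>
      (\<exists>C>0. \<forall>a. 0 < a \<and> a < 1 \<longrightarrow>
        near_truncation_fun scl qnorm x xs a \<le> C * thresholding_fun scl qnorm x xs a \<and>
        thresholding_fun scl qnorm x xs a \<le> C * near_unconditionality_fun scl qnorm x xs a \<and>
        near_unconditionality_fun scl qnorm x xs a
          \<le> C * (1 / a * near_truncation_fun scl qnorm x xs a)))"
proof -
  interpret quasi_banach_basis scl qnorm x xs by (rule assms)
  let ?lambda = "near_truncation_fun scl qnorm x xs"
    and ?theta = "thresholding_fun scl qnorm x xs"
    and ?phi = "near_unconditionality_fun scl qnorm x xs"
  have "\<exists>C>0. \<forall>a. 0 < a \<and> a < 1 \<longrightarrow> ?lambda a \<le> C * ?theta a \<and> ?theta a \<le> C * ?phi a \<and>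
      ?phi a \<le> C * (1 / a * ?lambda a)" if nu: "nearly_unconditional scl qnorm x xs"
  proof -
    have nt: "nearly_truncation_quasi_greedy scl qnorm x xs"
      using nu nearly_unconditional_iff_nearly_truncation_quasi_greedy by blast
    obtain c where c: "0 \<le> c" "\<And>a C. 0 < a \<Longrightarrow> thresholding_bound scl qnorm x xs a C
        \<Longrightarrow> near_truncation_bound scl qnorm x xs a (c * C)"
      using near_truncation_le_thresholding[OF nu] by blast
    obtain d where d: "0 \<le> d" "\<And>a C. 0 < a \<Longrightarrow> 0 \<le> C \<Longrightarrow> near_truncation_bound scl qnorm x xs a C
        \<Longrightarrow> near_unconditionality_bound scl qnorm x xs a (d * (1 / a * C))"
      using near_unconditionality_le_near_truncation[OF nt] by blast
    \<comment> \<open>The summand 1 covers theta against phi and makes the constant positive;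
      \<open>c\<close> and \<open>d\<close> cover the other two inequalities.\<close>
    have "?lambda a \<le> (1 + c + d) * ?theta a \<and> ?theta a \<le> (1 + c + d) * ?phi a \<and>
      ?phi a \<le> (1 + c + d) * (1 / a * ?lambda a)" if a: "0 < a" "a < 1" for a
    proof -
      \<comment> \<open>Each least constant is known to be attained before it feeds the next bound:
        phi, then theta, then lambda, and back to phi.\<close>
      obtain C where "near_unconditionality_bound scl qnorm x xs a C"
        using nu a unfolding nearly_unconditional_def by blast
      note phi = near_unconditionality_bound_Least[OF this]
      note th = thresholding_bound_if_near_unconditionality_bound[OF phi(2)]
      note theta = thresholding_bound_Least[OF th]
      note lam = c(2)[OF a(1) theta(2)]
      note lambda = near_truncation_bound_Least[OF lam]
      have phi_le: "?phi a \<le> d * (1 / a * ?lambda a)"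
        by (rule near_unconditionality_bound_Least(3)[OF d(2)[OF a(1) lambda(1,2)]])
      have enlarge: "s \<le> (1 + c + d) * t" if "s \<le> k * t" "k \<le> 1 + c + d" "0 \<le> t" for s t k :: real
        by (rule order_trans[OF that(1)]) (rule mult_right_mono[OF that(2,3)])
      show ?thesis
        using enlarge[OF lambda(3)] enlarge[of "?theta a" 1 "?phi a"] enlarge[OF phi_le]
          c(1) d(1) theta phi(1) lambda(1) a by simp
    qed
    then show ?thesis using c(1) d(1) by (intro exI[of _ "1 + c + d"]) auto
  qed
  then show ?thesis
    using nearly_unconditional_iff_nearly_truncation_quasi_greedy
      nearly_unconditional_imp_thresholding_bounded by blast
qed

end
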